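(* Let $G$ be a countable group and suppose $\varphi:X\to\tilde{\mathcal O}$ is a measure-theoretic factor map from a measure-preserving $G$-action $(X,\mu,G)$ to a multiorder $(\tilde{\mathcal O},\nu,G)$ on $G$. Then $(X,\mu,G)$ is orbit equivalent, via the identity map, to the $\mathbb Z$-action generated by the successor map $S:X\to X$ defined by $$S(x)=1^{\prec}(x),\quad\text{where }\prec\,=\varphi(x),$$ i.e. $S(x)=g(x)$ with $g=1^{\varphi(x)}=1^{\prec}\in G$. Moreover, for any $k\in\mathbb Z$, $$S^k(x)=k^{\prec}(x),\quad \prec\,=\varphi(x).$$ Let $\tilde S$ denote the transformation of $\tilde{\mathcal O}$ defined by $\tilde S(\prec)=1^{\prec}(\prec)$, i.e. $\tilde S(\prec)=g(\prec)$ with $g=1^{\prec}$. Then $\tilde S$ preserves the measure $\nu$, and $\varphi$ is a factor map from the $\mathbb Z$-action $(X,\mu,S)$ to the $\mathbb Z$-action $(\tilde{\mathcal O},\nu,\tilde S)$.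
   Context: $G$ is an infinite countable group with unit $e$. The actions of $G$ on $X$ and on $\tilde{\mathcal O}$ are not assumed free. A linear order $\prec$ on $G$ is of type $\mathbb Z$ if every order interval $[a,b]^{\prec}=\{a,b\}\cup\{g\in G: a\prec g\prec b\}$ ($a\prec b$) is finite and $G$ has no minimal or maximal element. The set $\tilde{\mathcal O}$ of all orders of type $\mathbb Z$ on $G$ is a Borel subset of $\{0,1\}^{G\times G}$ (relations identified with their indicator functions, product topology), with the inherited Borel sigma-algebra. $G$ acts on $\tilde{\mathcal O}$ by: $\prec'=g(\prec)$ where $a\prec' b\iff ag\prec bg$. A multiorder on $G$ is the measure-preserving action $(\tilde{\mathcal O},\nu,G)$, where $\nu$ is a $G$-invariant Borel probability measure on $\tilde{\mathcal O}$. For $\prec\,\in\tilde{\mathcal O}$, $i\mapsto i^{\prec}$ denotes the unique bijection $\mathbb Z\to G$ such that $0^{\prec}=e$ and $(i+1)^{\prec}$ is the successor of $i^{\prec}$ in $\prec$ for all $i\in\mathbb Z$. A measure-theoretic factor map is a measurable map defined $\mu$-almost everywhere, commuting with the actions $\mu$-almost everywhere and sending $\mu$ to $\nu$. Pointwise equalities on $X$ are understood for $\mu$-almost every $x$. Two measure-preserving actions on the same space $(X,\mu)$ are orbit equivalent via the identity map if for $\mu$-almost every $x$ the orbits of $x$ under the two actions coincide. *)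

theory Defs
  imports "HOL-Probability.Probability" "HOL-Algebra.Algebra"
begin

section \<open>Measure-preserving actions\<close>

definition measure_preserving_map :: "'x measure \<Rightarrow> ('x \<Rightarrow> 'x) \<Rightarrow> bool" where
  "measure_preserving_map M T \<longleftrightarrow> T \<in> M \<rightarrow>\<^sub>M M \<and> distr M M T = M"

definition mp_action :: "('g, 'm) monoid_scheme \<Rightarrow> 'x measure \<Rightarrow> ('g \<Rightarrow> 'x \<Rightarrow> 'x) \<Rightarrow> bool" where
  "mp_action G M \<alpha> \<longleftrightarrow>
     group_action G (space M) \<alpha> \<and> (\<forall>g\<in>carrier G. measure_preserving_map M (\<alpha> g))"

text \<open>
  A factor map is only defined on a conull measurable set \<open>D\<close>; its values outside \<open>D\<close> are
  irrelevant. Since \<open>\<alpha> g\<close> preserves the measure, almost every \<open>x\<close> satisfies both \<open>x \<in> D\<close> and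
  \<open>\<alpha> g x \<in> D\<close>, so the equivariance clause only concerns values of \<open>\<phi>\<close> on \<open>D\<close>.
\<close>

definition factor_map ::
  "('g, 'm) monoid_scheme \<Rightarrow> 'x measure \<Rightarrow> ('g \<Rightarrow> 'x \<Rightarrow> 'x) \<Rightarrow>
   'y measure \<Rightarrow> ('g \<Rightarrow> 'y \<Rightarrow> 'y) \<Rightarrow> 'x set \<Rightarrow> ('x \<Rightarrow> 'y) \<Rightarrow> bool" where
  "factor_map G M \<alpha> N \<beta> D \<phi> \<longleftrightarrow>
     D \<in> sets M \<and> (AE x in M. x \<in> D) \<and>
     \<phi> \<in> restrict_space M D \<rightarrow>\<^sub>M N \<and>
     (\<forall>g\<in>carrier G. AE x in M. \<phi> (\<alpha> g x) = \<beta> g (\<phi> x)) \<and>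
     distr (restrict_space M D) N \<phi> = N"

definition orbit_equivalent_via_id ::
  "'x measure \<Rightarrow> ('g, 'm) monoid_scheme \<Rightarrow> ('g \<Rightarrow> 'x \<Rightarrow> 'x) \<Rightarrow>
   ('h, 'n) monoid_scheme \<Rightarrow> ('h \<Rightarrow> 'x \<Rightarrow> 'x) \<Rightarrow> bool" where
  "orbit_equivalent_via_id M G \<alpha> H \<beta> \<longleftrightarrow>
     mp_action G M \<alpha> \<and> mp_action H M \<beta> \<and> (AE x in M. orbit G \<alpha> x = orbit H \<beta> x)"

text \<open>The action \<open>k \<mapsto> T\<^sup>k\<close> of the integers generated by a bijection \<open>T\<close> of \<open>E\<close>.\<close>

definition int_action :: "'x set \<Rightarrow> ('x \<Rightarrow> 'x) \<Rightarrow> int \<Rightarrow> 'x \<Rightarrow> 'x" where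
  "int_action E T k = T [^]\<^bsub>BijGroup E\<^esub> k"

text \<open>
  An almost everywhere defined map \<open>S\<close> generates an action of the integers on \<open>M\<close>, unique up to
  null sets, if it agrees almost everywhere with an invertible measure-preserving \<open>T\<close>.
  The powers \<open>S\<^sup>k\<close> are then \<open>int_action (space M) T k\<close>, up to null sets.
\<close>

definition invertible_version :: "'x measure \<Rightarrow> ('x \<Rightarrow> 'x) \<Rightarrow> ('x \<Rightarrow> 'x) \<Rightarrow> bool" where
  "invertible_version M S T \<longleftrightarrow>
     T \<in> Bij (space M) \<and> mp_action integer_group M (int_action (space M) T) \<and>
     (AE x in M. T x = S x)"

section \<open>Orders of type \<open>\<int>\<close> and multiorders\<close>

text \<open>Orders are strict: \<open>(a, b) \<in> r\<close> means \<open>a \<prec> b\<close>.\<close>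

definition order_interval :: "('g, 'm) monoid_scheme \<Rightarrow> 'g rel \<Rightarrow> 'g \<Rightarrow> 'g \<Rightarrow> 'g set" where
  "order_interval G r a b = {a, b} \<union> {g \<in> carrier G. (a, g) \<in> r \<and> (g, b) \<in> r}"

definition Z_orders :: "('g, 'm) monoid_scheme \<Rightarrow> 'g rel set" where
  "Z_orders G = {r. r \<subseteq> carrier G \<times> carrier G \<and> strict_linear_order_on (carrier G) r \<and>
     (\<forall>a b. (a, b) \<in> r \<longrightarrow> finite (order_interval G r a b)) \<and>
     (\<forall>a\<in>carrier G. \<exists>b\<in>carrier G. (b, a) \<in> r) \<and>
     (\<forall>a\<in>carrier G. \<exists>b\<in>carrier G. (a, b) \<in> r)}"

definition indicator_of_rel :: "('g, 'm) monoid_scheme \<Rightarrow> 'g rel \<Rightarrow> 'g \<times> 'g \<Rightarrow> bool" where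
  "indicator_of_rel G r = (\<lambda>p\<in>carrier G \<times> carrier G. p \<in> r)"

definition relation_topology :: "('g, 'm) monoid_scheme \<Rightarrow> ('g \<times> 'g \<Rightarrow> bool) topology" where
  "relation_topology G =
     product_topology (\<lambda>_. discrete_topology (UNIV :: bool set)) (carrier G \<times> carrier G)"

text \<open>
  The set of orders of type \<open>\<int>\<close> with the trace of the Borel sigma-algebra of the product topology.
\<close>

definition Z_orders_space :: "('g, 'm) monoid_scheme \<Rightarrow> 'g rel measure" where
  "Z_orders_space G = vimage_algebra (Z_orders G) (indicator_of_rel G)
     (sigma (topspace (relation_topology G)) {U. openin (relation_topology G) U})"

text \<open>Restricted to \<open>Z_orders G\<close> because elements of \<open>BijGroup\<close> are extensional.\<close>

definition order_act :: "('g, 'm) monoid_scheme \<Rightarrow> 'g \<Rightarrow> 'g rel \<Rightarrow> 'g rel" where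
  "order_act G g = (\<lambda>r\<in>Z_orders G.
     {(a, b). a \<in> carrier G \<and> b \<in> carrier G \<and> (a \<otimes>\<^bsub>G\<^esub> g, b \<otimes>\<^bsub>G\<^esub> g) \<in> r})"

definition multiorder :: "('g, 'm) monoid_scheme \<Rightarrow> 'g rel measure \<Rightarrow> bool" where
  "multiorder G \<nu> \<longleftrightarrow> prob_space \<nu> \<and> sets \<nu> = sets (Z_orders_space G) \<and>
     (\<forall>g\<in>carrier G. distr \<nu> \<nu> (order_act G g) = \<nu>)"

definition is_successor :: "'g rel \<Rightarrow> 'g \<Rightarrow> 'g \<Rightarrow> bool" where
  "is_successor r a b \<longleftrightarrow> (a, b) \<in> r \<and> (\<nexists>c. (a, c) \<in> r \<and> (c, b) \<in> r)"

text \<open>The element \<open>k\<^sup>\<prec>\<close> is \<open>order_index G r k\<close>, for \<open>r\<close> the order \<open>\<prec>\<close>.\<close>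

definition order_index :: "('g, 'm) monoid_scheme \<Rightarrow> 'g rel \<Rightarrow> int \<Rightarrow> 'g" where
  "order_index G r = (THE f. bij_betw f UNIV (carrier G) \<and> f 0 = \<one>\<^bsub>G\<^esub> \<and>
     (\<forall>i. is_successor r (f i) (f (i + 1))))"

section \<open>Successor maps\<close>

definition succ_map ::
  "('g, 'm) monoid_scheme \<Rightarrow> ('g \<Rightarrow> 'x \<Rightarrow> 'x) \<Rightarrow> ('x \<Rightarrow> 'g rel) \<Rightarrow> 'x \<Rightarrow> 'x" where
  "succ_map G \<alpha> \<phi> x = \<alpha> (order_index G (\<phi> x) 1) x"

definition succ_order :: "('g, 'm) monoid_scheme \<Rightarrow> 'g rel \<Rightarrow> 'g rel" where
  "succ_order G = (\<lambda>r\<in>Z_orders G. order_act G (order_index G r 1) r)"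

end

theory Submission
  imports Defs
begin

text \<open>
  If \<open>g = k\<^sup>\<prec>\<close>, then right multiplication by \<open>g\<close> is an isomorphism from \<open>g(\<prec>)\<close> to \<open>\<prec>\<close> which takes
  the unit to \<open>g\<close>, so the element with index \<open>l\<close> in \<open>g(\<prec>)\<close> multiplied by \<open>g\<close> is \<open>(l + k)\<^sup>\<prec>\<close>.
  On an invariant conull set where \<open>\<phi>\<close> is everywhere equivariant this is the cocycle identity
  saying that the maps \<open>x \<mapsto> k\<^sup>\<prec>(x)\<close>, \<open>\<prec> = \<phi>(x)\<close>, form an action of \<open>\<int>\<close>. Its orbits are those
  of \<open>G\<close> because \<open>k \<mapsto> k\<^sup>\<prec>\<close> is onto \<open>G\<close>, and each of these maps preserves the measure because it
  is a bijection that coincides with elements of \<open>G\<close> on the pieces of a countable measurable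
  partition.
\<close>

section \<open>Orders of type \<open>\<int>\<close>\<close>

lemma Z_ordersD:
  assumes "r \<in> Z_orders G"
  shows "r \<subseteq> carrier G \<times> carrier G" "trans r" "irrefl r" "total_on (carrier G) r"
    "\<And>a b. (a, b) \<in> r \<Longrightarrow> finite (order_interval G r a b)"
    "\<And>a. a \<in> carrier G \<Longrightarrow> \<exists>b\<in>carrier G. (b, a) \<in> r"
    "\<And>a. a \<in> carrier G \<Longrightarrow> \<exists>b\<in>carrier G. (a, b) \<in> r"
  using assms by (auto simp: Z_orders_def strict_linear_order_on_def)

text \<open>Reversal swaps the ends of intervals and exchanges successors with predecessors, so
  facts about successors also yield their mirror images.\<close>

lemma converse_Z_orders:
  assumes "r \<in> Z_orders G"
  shows "r\<inverse> \<in> Z_orders G"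
proof -
  have "order_interval G (r\<inverse>) a b = order_interval G r b a" for a b
    by (auto simp: order_interval_def)
  then show ?thesis
    using Z_ordersD[OF assms]
    by (auto simp: Z_orders_def strict_linear_order_on_def irrefl_def)
qed

lemma is_successor_converse [simp]: "is_successor (r\<inverse>) a b \<longleftrightarrow> is_successor r b a"
  by (auto simp: is_successor_def)

text \<open>Above \<open>a\<close>, choose an element whose interval from \<open>a\<close> has least
  cardinality: anything strictly between would give a strictly smaller finite interval.\<close>

lemma ex_successor:
  assumes r: "r \<in> Z_orders G" and a: "a \<in> carrier G"
  shows "\<exists>b\<in>carrier G. is_successor r a b"
proof -
  obtain b0 where b0: "(a, b0) \<in> r" using Z_ordersD(7)[OF r a] by auto
  obtain b where b: "(a, b) \<in> r"
    and least: "\<And>c. (a, c) \<in> r \<Longrightarrow> card (order_interval G r a b) \<le> card (order_interval G r a c)"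
    using ex_has_least_nat[of "\<lambda>b. (a, b) \<in> r" b0 "\<lambda>b. card (order_interval G r a b)"] b0 by auto
  have "\<not> ((a, c) \<in> r \<and> (c, b) \<in> r)" for c
  proof
    assume c: "(a, c) \<in> r \<and> (c, b) \<in> r"
    have "order_interval G r a c \<subset> order_interval G r a b"
      using c b Z_ordersD(1,2,3)[OF r]
      by (auto simp: order_interval_def irrefl_def dest: transD)
    then have "card (order_interval G r a c) < card (order_interval G r a b)"
      using Z_ordersD(5)[OF r b] by (rule psubset_card_mono[rotated])
    with least[of c] c show False by simp
  qed
  then show ?thesis using b Z_ordersD(1)[OF r] by (auto simp: is_successor_def)
qed

lemma is_successor_unique:
  assumes r: "r \<in> Z_orders G" and "is_successor r a b" "is_successor r a c"
  shows "b = c"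
  using assms Z_ordersD(1,4)[OF r] unfolding is_successor_def total_on_def by blast

lemma is_predecessor_unique:
  assumes "r \<in> Z_orders G" "is_successor r b a" "is_successor r c a"
  shows "b = c"
  using is_successor_unique[OF converse_Z_orders[OF assms(1)]] assms(2,3) by simp

text \<open>A step cannot jump over \<open>g\<close>, so a chain missing \<open>g\<close> would stay
  below it forever and put infinitely many distinct elements into one finite interval.\<close>

lemma successor_chain_reaches:
  fixes h :: "nat \<Rightarrow> 'g"
  assumes r: "r \<in> Z_orders G" and h: "\<And>n. is_successor r (h n) (h (Suc n))"
    and g: "(h 0, g) \<in> r"
  shows "\<exists>n. h n = g"
proof (rule ccontr)
  assume neq: "\<nexists>n. h n = g"
  have step: "(h n, h (Suc n)) \<in> r" for n using h by (simp add: is_successor_def)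
  have less: "(h m, h n) \<in> r" if "m < n" for m n
    using that
  proof (induction n)
    case (Suc n)
    then show ?case using step[of n] Z_ordersD(2)[OF r] by (auto simp: less_Suc_eq dest: transD)
  qed simp
  have "(h n, g) \<in> r" for n
  proof (induction n)
    case (Suc n)
    then show ?case
      using h[of n] neq step[of n] Z_ordersD(1,4)[OF r] unfolding is_successor_def total_on_def by blast
  qed (rule g)
  then have "range h \<subseteq> order_interval G r (h 0) g"
    using less Z_ordersD(1)[OF r] by (auto simp: order_interval_def) (metis gr0I)
  moreover have "inj h"
    using less Z_ordersD(3)[OF r] by (intro linorder_injI) (auto simp: irrefl_def, metis)
  ultimately show False
    using Z_ordersD(5)[OF r g] finite_subset range_inj_infinite by blast
qed

text \<open>Iterated successors of \<open>e\<close> exhaust the elements above it and iterated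
  predecessors those below it; strict monotonicity gives injectivity.\<close>

lemma Z_order_enumeration:
  assumes r: "r \<in> Z_orders G" and e: "e \<in> carrier G"
  shows "\<exists>f :: int \<Rightarrow> 'g. bij_betw f UNIV (carrier G) \<and> f 0 = e \<and>
    (\<forall>i. is_successor r (f i) (f (i + 1)))"
proof -
  note r' = converse_Z_orders[OF r]
  obtain s where s: "\<And>a. a \<in> carrier G \<Longrightarrow> s a \<in> carrier G \<and> is_successor r a (s a)"
    using ex_successor[OF r] by metis
  obtain p where p: "\<And>a. a \<in> carrier G \<Longrightarrow> p a \<in> carrier G \<and> is_successor r (p a) a"
    using ex_successor[OF r'] by (metis is_successor_converse)
  have sC: "(s ^^ n) e \<in> carrier G" for n using s e by (induction n) auto
  have pC: "(p ^^ n) e \<in> carrier G" for n using p e by (induction n) auto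
  define f where "f i = (if 0 \<le> i then (s ^^ nat i) e else (p ^^ nat (- i)) e)" for i :: int
  have fC: "f i \<in> carrier G" for i by (simp add: f_def sC pC)
  have step: "is_successor r (f i) (f (i + 1))" for i
  proof (cases "0 \<le> i")
    case True
    then have "f (i + 1) = s (f i)" by (simp add: f_def nat_add_distrib)
    then show ?thesis using s fC by simp
  next
    case False
    \<comment> \<open>At \<open>i = -1\<close> the right end is \<open>f 0\<close>, defined by the
      other branch; the two branches agree there, both zeroth iterates being
      \<open>e\<close>.\<close>
    then have "nat (- i) = Suc (nat (- (i + 1)))" by simp
    then have "f i = p (f (i + 1))" using False by (auto simp: f_def)
    then show ?thesis using p fC by simp
  qed
  have less: "(f i, f j) \<in> r" if "i < j" for i j
    using that
  proof (induction j rule: int_gr_induct)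
    case base
    then show ?case using step by (simp add: is_successor_def)
  next
    case (step j)
    then show ?case using \<open>\<And>i. is_successor r (f i) (f (i + 1))\<close>[of j] Z_ordersD(2)[OF r]
      by (auto simp: is_successor_def dest: transD)
  qed
  have "inj f"
    using less Z_ordersD(3)[OF r] by (intro linorder_injI) (auto simp: irrefl_def, metis)
  moreover have "carrier G \<subseteq> range f"
  proof
    fix g assume g: "g \<in> carrier G"
    consider "g = e" | "(e, g) \<in> r" | "(e, g) \<in> r\<inverse>"
      using Z_ordersD(4)[OF r] g e by (auto simp: total_on_def)
    then show "g \<in> range f"
    proof cases
      case 1
      then have "f 0 = g" by (simp add: f_def)
      then show ?thesis by blast
    next
      case 2
      then obtain n where "(s ^^ n) e = g"
        using successor_chain_reaches[OF r, of "\<lambda>n. (s ^^ n) e"] s sC by auto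
      then have "f (int n) = g" by (simp add: f_def)
      then show ?thesis by blast
    next
      case 3
      then obtain n where "(p ^^ n) e = g"
        using successor_chain_reaches[OF r', of "\<lambda>n. (p ^^ n) e"] p pC by auto
      then have "f (- int n) = g" by (cases "n = 0") (simp_all add: f_def)
      then show ?thesis by blast
    qed
  qed
  ultimately have "bij_betw f UNIV (carrier G)" using fC by (auto simp: bij_betw_def)
  moreover have "f 0 = e" by (simp add: f_def)
  ultimately show ?thesis using step by blast
qed

lemma Z_order_enumeration_unique:
  fixes f f' :: "int \<Rightarrow> 'g"
  assumes r: "r \<in> Z_orders G" and "f 0 = f' 0"
    and f: "\<And>i. is_successor r (f i) (f (i + 1))" and f': "\<And>i. is_successor r (f' i) (f' (i + 1))"
  shows "f = f'"
proof
  fix i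
  show "f i = f' i"
  proof (induction i rule: int_induct[where k = 0])
    case (step1 i)
    then show ?case using is_successor_unique[OF r f[of i]] f'[of i] by simp
  next
    case (step2 i)
    then show ?case using is_predecessor_unique[OF r f[of "i - 1"]] f'[of "i - 1"] by simp
  qed (rule assms(2))
qed

section \<open>The index enumeration and the group action on orders\<close>

context group
begin

text \<open>Existence and uniqueness of the enumeration justify the definite description in
  \<open>order_index\<close>.\<close>

lemma order_index:
  assumes r: "r \<in> Z_orders G"
  shows "bij_betw (order_index G r) UNIV (carrier G)" "order_index G r 0 = \<one>"
    "is_successor r (order_index G r i) (order_index G r (i + 1))"
proof -
  let ?P = "\<lambda>f :: int \<Rightarrow> 'a. bij_betw f UNIV (carrier G) \<and> f 0 = \<one> \<and> (\<forall>i. is_successor r (f i) (f (i + 1)))"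
  have "f = f'" if "?P f" "?P f'" for f f'
    using that by (intro Z_order_enumeration_unique[OF r]) auto
  then have "\<exists>!f. ?P f"
    using Z_order_enumeration[OF r one_closed] by (rule ex_ex1I[rotated])
  then have "?P (order_index G r)" unfolding order_index_def by (rule theI')
  then show "bij_betw (order_index G r) UNIV (carrier G)" "order_index G r 0 = \<one>"
    "is_successor r (order_index G r i) (order_index G r (i + 1))" by auto
qed

lemma order_index_closed [simp, intro]: "r \<in> Z_orders G \<Longrightarrow> order_index G r k \<in> carrier G"
  using order_index(1) by (auto simp: bij_betw_def)

text \<open>Right multiplication by \<open>g\<close> is a bijection of the group and an isomorphism
  from the new order to \<open>r\<close>, so every defining property is pulled back along
  it.\<close>

lemma order_act_closed:
  assumes r: "r \<in> Z_orders G" and g: "g \<in> carrier G"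
  shows "order_act G g r \<in> Z_orders G"
proof -
  define r' where "r' = {(a, b). a \<in> carrier G \<and> b \<in> carrier G \<and> (a \<otimes> g, b \<otimes> g) \<in> r}"
  have ext: "\<exists>a\<in>carrier G. b = a \<otimes> g" if "b \<in> carrier G" for b
    using that g by (intro bexI[of _ "b \<otimes> inv g"]) (auto simp: m_assoc)
  have "finite (order_interval G r' a b)" if "(a, b) \<in> r'" for a b
  proof -
    have "(\<lambda>c. c \<otimes> g) ` order_interval G r' a b \<subseteq> order_interval G r (a \<otimes> g) (b \<otimes> g)"
      using g by (auto simp: order_interval_def r'_def)
    moreover have "finite (order_interval G r (a \<otimes> g) (b \<otimes> g))"
      using Z_ordersD(5)[OF r] that by (auto simp: r'_def)
    moreover have "inj_on (\<lambda>c. c \<otimes> g) (order_interval G r' a b)"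
      using that g by (auto simp: order_interval_def r'_def inj_on_def)
    ultimately show ?thesis by (meson finite_imageD finite_subset)
  qed
  moreover have "trans r'" "irrefl r'" "total_on (carrier G) r'"
    using Z_ordersD(2-4)[OF r] g
    by (auto simp: r'_def trans_def irrefl_def total_on_def)
  moreover have "\<exists>b\<in>carrier G. (b, a) \<in> r'" "\<exists>b\<in>carrier G. (a, b) \<in> r'" if "a \<in> carrier G" for a
    using Z_ordersD(6,7)[OF r, of "a \<otimes> g"] that g ext by (auto simp: r'_def)
  ultimately have "r' \<in> Z_orders G"
    by (auto simp: Z_orders_def strict_linear_order_on_def r'_def)
  then show ?thesis using r by (simp add: order_act_def r'_def)
qed

lemma order_act_iff:
  assumes "r \<in> Z_orders G"
  shows "(a, b) \<in> order_act G g r \<longleftrightarrow>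
    a \<in> carrier G \<and> b \<in> carrier G \<and> (a \<otimes> g, b \<otimes> g) \<in> r"
  using assms by (simp add: order_act_def)

text \<open>Applying \<open>h\<close> and then \<open>g\<close> compares
  \<open>a \<otimes> g \<otimes> h\<close> with \<open>b \<otimes> g \<otimes> h\<close> in
  \<open>r\<close>, so right translation gives a left action.\<close>

lemma order_act_mult:
  assumes r: "r \<in> Z_orders G" and gh: "g \<in> carrier G" "h \<in> carrier G"
  shows "order_act G (g \<otimes> h) r = order_act G g (order_act G h r)"
  using assms order_act_closed[OF r gh(2)] by (auto simp: order_act_def m_assoc)

lemma order_act_one:
  assumes "r \<in> Z_orders G"
  shows "order_act G \<one> r = r"
  using assms Z_ordersD(1)[OF assms] by (auto simp: order_act_def)

lemma group_action_order_act: "group_action G (Z_orders G) (order_act G)"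
proof -
  have closed: "order_act G g r \<in> Z_orders G" if "g \<in> carrier G" "r \<in> Z_orders G" for g r
    using that by (simp add: order_act_closed)
  have bij: "order_act G g \<in> Bij (Z_orders G)" if g: "g \<in> carrier G" for g
  proof -
    have "bij_betw (order_act G g) (Z_orders G) (Z_orders G)"
      by (rule bij_betw_byWitness[where f' = "order_act G (inv g)"])
        (use g closed in \<open>auto simp: order_act_mult[symmetric] order_act_one\<close>)
    then show ?thesis by (simp add: Bij_def order_act_def)
  qed
  have "order_act G (g \<otimes> h) = compose (Z_orders G) (order_act G g) (order_act G h)"
    if "g \<in> carrier G" "h \<in> carrier G" for g h
  proof (rule extensionalityI[where A = "Z_orders G"])
    show "order_act G (g \<otimes> h) \<in> extensional (Z_orders G)" by (simp add: order_act_def)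
  qed (use that in \<open>simp_all add: compose_def order_act_mult\<close>)
  then show ?thesis
    using bij group_BijGroup[of "Z_orders G"]
    by (intro group_action.intro group_hom.intro group_hom_axioms.intro homI)
      (auto simp: BijGroup_def is_group)
qed

lemma order_index_shift:
  assumes r: "r \<in> Z_orders G"
  shows "order_index G (order_act G (order_index G r k) r) l \<otimes> order_index G r k =
    order_index G r (l + k)"
proof -
  let ?g = "order_index G r k"
  let ?f = "order_index G (order_act G ?g r)"
  have g: "?g \<in> carrier G" using r by simp
  have r': "order_act G ?g r \<in> Z_orders G" using r g by (rule order_act_closed)
  have succ: "is_successor r (a \<otimes> ?g) (b \<otimes> ?g)"
    if s: "is_successor (order_act G ?g r) a b" for a b
  proof -
    have ab: "a \<in> carrier G" "b \<in> carrier G" "(a \<otimes> ?g, b \<otimes> ?g) \<in> r"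
      using s r by (auto simp: is_successor_def order_act_iff)
    \<comment> \<open>An element between the translates would, after multiplication by
      \<open>inv ?g\<close>, lie between \<open>a\<close> and \<open>b\<close>.\<close>
    have False if c: "(a \<otimes> ?g, c) \<in> r" "(c, b \<otimes> ?g) \<in> r" for c
    proof -
      have "c \<in> carrier G" using c Z_ordersD(1)[OF r] by auto
      then have "c \<otimes> inv ?g \<in> carrier G" "c \<otimes> inv ?g \<otimes> ?g = c"
        using g by (auto simp: m_assoc)
      then show False
        using c s ab r unfolding is_successor_def by (metis order_act_iff)
    qed
    then show ?thesis using ab by (auto simp: is_successor_def)
  qed
  \<comment> \<open>As functions of \<open>l\<close>, both sides step through successors in
    \<open>r\<close> and have the value \<open>?g\<close> at 0.\<close>
  have "(\<lambda>l. ?f l \<otimes> ?g) = (\<lambda>l. order_index G r (l + k))"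
  proof (rule Z_order_enumeration_unique[OF r])
    show "?f 0 \<otimes> ?g = order_index G r (0 + k)"
      using order_index(2)[OF r'] g by simp
    show "is_successor r (?f i \<otimes> ?g) (?f (i + 1) \<otimes> ?g)" for i
      by (intro succ order_index(3) r')
    show "is_successor r (order_index G r (i + k)) (order_index G r (i + 1 + k))" for i
      using order_index(3)[OF r, of "i + k"] by (simp add: algebra_simps)
  qed
  then show ?thesis by meson
qed

end

section \<open>Measurability\<close>

lemma space_Z_orders_space [simp]: "space (Z_orders_space G) = Z_orders G"
  by (simp add: Z_orders_space_def)

lemma topspace_relation_topology:
  "topspace (relation_topology G) = extensional (carrier G \<times> carrier G)"
  by (auto simp: relation_topology_def PiE_def)

lemma indicator_of_rel_topspace [simp]: "indicator_of_rel G r \<in> topspace (relation_topology G)"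
  by (simp add: topspace_relation_topology indicator_of_rel_def)

lemma sets_Z_orders_space_openin:
  assumes "openin (relation_topology G) U"
  shows "{r \<in> Z_orders G. indicator_of_rel G r \<in> U} \<in> sets (Z_orders_space G)"
proof -
  have "U \<in> sets (sigma (topspace (relation_topology G)) {U. openin (relation_topology G) U})"
    using assms openin_subset by (subst sets_measure_of) auto
  from in_vimage_algebra[OF this, of "indicator_of_rel G" "Z_orders G"]
  show ?thesis by (simp add: Z_orders_space_def vimage_def Int_def conj_commute)
qed

text \<open>The target sigma-algebra is pulled back from one generated by open sets, so preimages of
  open sets suffice.\<close>

lemma measurable_into_Z_orders_space:
  assumes "f \<in> space N \<rightarrow> Z_orders G"
    and "\<And>U. openin (relation_topology G) U \<Longrightarrow>
      {x \<in> space N. indicator_of_rel G (f x) \<in> U} \<in> sets N"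
  shows "f \<in> N \<rightarrow>\<^sub>M Z_orders_space G"
  unfolding Z_orders_space_def
proof (rule measurable_vimage_algebra2)
  show "(\<lambda>x. indicator_of_rel G (f x)) \<in>
    N \<rightarrow>\<^sub>M sigma (topspace (relation_topology G)) {U. openin (relation_topology G) U}"
    by (rule measurable_measure_of)
      (use assms(2) openin_subset in \<open>auto simp: vimage_def Int_def conj_commute\<close>)
qed (rule assms(1))

text \<open>Evaluation at a coordinate is continuous, so the set is the trace of an open
  cylinder.\<close>

lemma sets_rel_pair:
  assumes "a \<in> carrier G" "b \<in> carrier G"
  shows "{r \<in> Z_orders G. (a, b) \<in> r} \<in> sets (Z_orders_space G)"
proof -
  have "openin (relation_topology G) {f \<in> topspace (relation_topology G). f (a, b) \<in> {True}}"
    unfolding relation_topology_def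
    by (rule openin_continuous_map_preimage[OF continuous_map_product_projection]) (use assms in auto)
  from sets_Z_orders_space_openin[OF this] show ?thesis
    using assms by (simp add: indicator_of_rel_topspace[unfolded mem_Collect_eq])
      (simp add: indicator_of_rel_def)
qed

context group
begin

lemma measurable_order_act:
  assumes g: "g \<in> carrier G"
  shows "order_act G g \<in> Z_orders_space G \<rightarrow>\<^sub>M Z_orders_space G"
proof (rule measurable_into_Z_orders_space)
  show "order_act G g \<in> space (Z_orders_space G) \<rightarrow> Z_orders G"
    using g by (simp add: order_act_closed)
next
  fix U assume U: "openin (relation_topology G) U"
  \<comment> \<open>On indicator functions the action is the substitution \<open>h\<close>,
    continuous because each coordinate of \<open>h f\<close> is a coordinate of
    \<open>f\<close>.\<close>
  define h :: "('a \<times> 'a \<Rightarrow> bool) \<Rightarrow> 'a \<times> 'a \<Rightarrow> bool"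
    where "h f = (\<lambda>(a, b)\<in>carrier G \<times> carrier G. f (a \<otimes> g, b \<otimes> g))" for f
  have "continuous_map (relation_topology G) (discrete_topology UNIV) (\<lambda>f. h f k)"
    if "k \<in> carrier G \<times> carrier G" for k
    using that g unfolding relation_topology_def h_def
    by (cases k) (auto intro!: continuous_map_product_projection)
  then have "continuous_map (relation_topology G) (relation_topology G) h"
    by (subst (2) relation_topology_def) (auto simp: continuous_map_componentwise h_def)
  then have "openin (relation_topology G) {f \<in> topspace (relation_topology G). h f \<in> U}"
    using U by (rule openin_continuous_map_preimage)
  moreover have "indicator_of_rel G (order_act G g r) = h (indicator_of_rel G r)"
    if "r \<in> Z_orders G" for r
    using that g by (auto simp: h_def indicator_of_rel_def order_act_iff fun_eq_iff)
  ultimately show "{r \<in> space (Z_orders_space G). indicator_of_rel G (order_act G g r) \<in> U}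
      \<in> sets (Z_orders_space G)"
    using sets_Z_orders_space_openin by (fastforce cong: conj_cong)
qed

text \<open>Countability of the group turns the absence of an intermediate element into a countable
  intersection of cylinder conditions.\<close>

lemma sets_is_successor:
  assumes C: "countable (carrier G)" and ab: "a \<in> carrier G" "b \<in> carrier G"
  shows "{r \<in> Z_orders G. is_successor r a b} \<in> sets (Z_orders_space G)"
proof -
  have "{r \<in> space (Z_orders_space G). \<forall>c\<in>carrier G. \<not> ((a, c) \<in> r \<and> (c, b) \<in> r)}
      \<in> sets (Z_orders_space G)"
    using ab
    by (intro sets.sets_Collect_countable_All' sets.sets_Collect_neg sets.sets_Collect_conj C)
      (simp_all add: sets_rel_pair)
  with sets_rel_pair[OF ab]
  have "{r \<in> Z_orders G. (a, b) \<in> r} \<inter>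
      {r \<in> Z_orders G. \<forall>c\<in>carrier G. \<not> ((a, c) \<in> r \<and> (c, b) \<in> r)} \<in> sets (Z_orders_space G)"
    by auto
  also have "{r \<in> Z_orders G. (a, b) \<in> r} \<inter>
      {r \<in> Z_orders G. \<forall>c\<in>carrier G. \<not> ((a, c) \<in> r \<and> (c, b) \<in> r)} =
      {r \<in> Z_orders G. is_successor r a b}"
    unfolding is_successor_def using Z_ordersD(1)[of _ G] by blast
  finally show ?thesis .
qed

text \<open>Induction in both directions from 0: the level sets at a neighbouring index are
  countable unions over the value \<open>h\<close> at the current index.\<close>

lemma sets_order_index:
  assumes C: "countable (carrier G)" and "g \<in> carrier G"
  shows "{r \<in> Z_orders G. order_index G r k = g} \<in> sets (Z_orders_space G)"
  using \<open>g \<in> carrier G\<close>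
proof (induction k arbitrary: g rule: int_induct[where k = 0])
  case base
  have "{r \<in> Z_orders G. order_index G r 0 = g} = (if g = \<one> then space (Z_orders_space G) else {})"
    by (auto simp: order_index(2))
  then show ?case by (metis sets.empty_sets sets.top)
next
  case (step1 i)
  have "{r \<in> Z_orders G. order_index G r (i + 1) = g} =
    (\<Union>h\<in>carrier G. {r \<in> Z_orders G. order_index G r i = h} \<inter> {r \<in> Z_orders G. is_successor r h g})"
    using order_index(3)[of _ i] is_successor_unique by fastforce
  also have "\<dots> \<in> sets (Z_orders_space G)"
    using step1 C by (intro sets.countable_UN') (auto intro!: sets.Int sets_is_successor)
  finally show ?case .
next
  case (step2 i)
  have "is_successor r (order_index G r (i - 1)) (order_index G r i)" if "r \<in> Z_orders G" for r
    using order_index(3)[OF that, of "i - 1"] by simp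
  then have "{r \<in> Z_orders G. order_index G r (i - 1) = g} =
    (\<Union>h\<in>carrier G. {r \<in> Z_orders G. order_index G r i = h} \<inter> {r \<in> Z_orders G. is_successor r g h})"
    using is_predecessor_unique by fastforce
  also have "\<dots> \<in> sets (Z_orders_space G)"
    using step2 C by (intro sets.countable_UN') (auto intro!: sets.Int sets_is_successor)
  finally show ?case .
qed

end

section \<open>Integer powers and measure-preserving maps\<close>

lemma group_action_int_action:
  assumes "T \<in> Bij E"
  shows "group_action integer_group E (int_action E T)"
proof -
  have "(\<lambda>k. int_action E T k) \<in> hom integer_group (BijGroup E)"
    unfolding int_action_def
    by (rule group.hom_integer_group_pow[OF group_BijGroup]) (simp add: BijGroup_def assms)
  then show ?thesis
    by (intro group_action.intro group_hom.intro group_hom_axioms.intro)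
      (simp_all add: group_BijGroup)
qed

lemma int_action_add:
  assumes "T \<in> Bij E" "x \<in> E"
  shows "int_action E T (k + l) x = int_action E T k (int_action E T l x)"
  using group_action.composition_rule[OF group_action_int_action[OF assms(1)] assms(2), of k l]
  by simp

lemma int_action_0: "x \<in> E \<Longrightarrow> int_action E T 0 x = x"
  by (simp add: int_action_def BijGroup_def)

lemma int_action_1: "T \<in> Bij E \<Longrightarrow> int_action E T 1 = T"
  unfolding int_action_def
  by (rule group.int_pow_1[OF group_BijGroup]) (simp add: BijGroup_def)

text \<open>As 1 generates the integers, an additive family of bijections consists of the powers of
  its value at 1.\<close>

lemma int_action_eqI:
  assumes "\<And>k. F k \<in> Bij E" and "\<And>k l. F (k + l) = compose E (F k) (F l)"
  shows "int_action E (F 1) = F"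
proof
  fix k :: int
  have "group_hom integer_group (BijGroup E) F"
    using assms
    by (intro group_hom.intro group_hom_axioms.intro homI group_BijGroup group_integer_group)
      (simp_all add: BijGroup_def)
  from group_hom.hom_int_pow[OF this, of 1 k]
  show "int_action E (F 1) k = F k" by (simp add: int_action_def)
qed

lemma measure_preserving_emeasure_vimage:
  assumes "measure_preserving_map M f" "A \<in> sets M"
  shows "emeasure M (f -` A \<inter> space M) = emeasure M A"
  using assms emeasure_distr[of f M M A] by (simp add: measure_preserving_map_def)

lemma measure_preserving_AE:
  assumes "measure_preserving_map M f" "AE x in M. P x"
  shows "AE x in M. P (f x)"
  using AE_distrD[of f M M P] assms by (metis measure_preserving_map_def)

section \<open>Equivariant fields of orders\<close>

text \<open>
  The induced \<open>\<int>\<close>-action on an invariant set carrying an equivariant field of orders \<open>\<psi>\<close>;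
  it covers both \<open>M\<close> with \<open>\<psi> = \<phi>\<close> and the multiorder itself with \<open>\<psi> = id\<close>.
\<close>

locale order_field = group G for G :: "('g, 'm) monoid_scheme" (structure) +
  fixes M :: "'x measure" and \<alpha> :: "'g \<Rightarrow> 'x \<Rightarrow> 'x" and Y :: "'x set" and \<psi> :: "'x \<Rightarrow> 'g rel"
  assumes countable_carrier: "countable (carrier G)"
    and mp_action: "mp_action G M \<alpha>"
    and Y_sets: "Y \<in> sets M"
    and Y_invariant: "g \<in> carrier G \<Longrightarrow> x \<in> Y \<Longrightarrow> \<alpha> g x \<in> Y"
    and equivariant: "g \<in> carrier G \<Longrightarrow> x \<in> Y \<Longrightarrow> \<psi> (\<alpha> g x) = order_act G g (\<psi> x)"
    and \<psi>_measurable: "\<psi> \<in> restrict_space M Y \<rightarrow>\<^sub>M Z_orders_space G"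
begin

definition index :: "int \<Rightarrow> 'x \<Rightarrow> 'g" where
  "index k x = order_index G (\<psi> x) k"

text \<open>The identity off \<open>Y\<close> makes each power a bijection of the whole space rather
  than of \<open>Y\<close> alone; \<open>Bij\<close> requires the extensional restriction.\<close>

definition succ_pow :: "int \<Rightarrow> 'x \<Rightarrow> 'x" where
  "succ_pow k = (\<lambda>x\<in>space M. if x \<in> Y then \<alpha> (index k x) x else x)"

sublocale group_action G "space M" \<alpha>
  using mp_action by (simp add: mp_action_def)

lemma Y_space: "x \<in> Y \<Longrightarrow> x \<in> space M"
  using sets.sets_into_space[OF Y_sets] by auto

lemma \<alpha>_closed [simp]: "g \<in> carrier G \<Longrightarrow> x \<in> space M \<Longrightarrow> \<alpha> g x \<in> space M"
  using surj_prop by blast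

lemma \<alpha>_one [simp]: "x \<in> space M \<Longrightarrow> \<alpha> \<one> x = x"
  using id_eq_one by (metis restrict_apply')

lemma \<psi>_Z_orders: "x \<in> Y \<Longrightarrow> \<psi> x \<in> Z_orders G"
  using measurable_space[OF \<psi>_measurable] Y_space by (auto simp: space_restrict_space)

lemma index_closed [simp]: "x \<in> Y \<Longrightarrow> index k x \<in> carrier G"
  by (simp add: index_def \<psi>_Z_orders)

lemma index_0: "x \<in> Y \<Longrightarrow> index 0 x = \<one>"
  by (simp add: index_def \<psi>_Z_orders order_index(2))

lemma index_surj:
  assumes "x \<in> Y"
  shows "carrier G = range (\<lambda>k. index k x)"
  using order_index(1)[OF \<psi>_Z_orders[OF assms]] by (auto simp: index_def bij_betw_def)

text \<open>By equivariance the order at the moved point is the translated order, so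
  \<open>order_index_shift\<close> becomes a cocycle identity over \<open>\<alpha>\<close>.\<close>

lemma index_add:
  assumes "x \<in> Y"
  shows "index l (\<alpha> (index k x) x) \<otimes> index k x = index (l + k) x"
  using order_index_shift[OF \<psi>_Z_orders[OF assms]] equivariant[OF index_closed assms] assms
  by (simp add: index_def)

lemma index_uminus:
  assumes "x \<in> Y"
  shows "index (- k) (\<alpha> (index k x) x) = inv (index k x)"
  using index_add[OF assms, of "- k" k] assms Y_invariant
  by (intro inv_equality[symmetric]) (simp_all add: index_0)

lemma sets_index:
  assumes "g \<in> carrier G"
  shows "{x \<in> Y. index k x = g} \<in> sets M"
proof -
  have "\<psi> -` {r \<in> Z_orders G. order_index G r k = g} \<inter> space (restrict_space M Y)
      \<in> sets (restrict_space M Y)"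
    using \<psi>_measurable sets_order_index[OF countable_carrier assms] by (rule measurable_sets)
  also have "\<psi> -` {r \<in> Z_orders G. order_index G r k = g} \<inter> space (restrict_space M Y) =
      {x \<in> Y. index k x = g}"
    using \<psi>_Z_orders Y_space by (auto simp: space_restrict_space index_def)
  finally show ?thesis using Y_sets by (simp add: sets_restrict_space_iff)
qed

lemma succ_pow_Y: "x \<in> Y \<Longrightarrow> succ_pow k x = \<alpha> (index k x) x"
  by (simp add: succ_pow_def Y_space)

lemma succ_pow_closed: "x \<in> space M \<Longrightarrow> succ_pow k x \<in> space M"
  by (simp add: succ_pow_def)

lemma succ_pow_add: "succ_pow (k + l) = compose (space M) (succ_pow k) (succ_pow l)"
proof (rule extensionalityI[where A = "space M"])
  fix x assume x: "x \<in> space M"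
  show "succ_pow (k + l) x = compose (space M) (succ_pow k) (succ_pow l) x"
  proof (cases "x \<in> Y")
    case True
    then show ?thesis
      using x Y_invariant[OF index_closed[OF True] True]
      by (simp add: compose_def succ_pow_Y index_add[symmetric] composition_rule Y_invariant)
  next
    case False
    then show ?thesis using x by (simp add: compose_def succ_pow_def)
  qed
qed (simp_all add: succ_pow_def)

lemma succ_pow_0: "x \<in> space M \<Longrightarrow> succ_pow 0 x = x"
  by (simp add: succ_pow_def index_0)

lemma succ_pow_Bij: "succ_pow k \<in> Bij (space M)"
proof -
  have "succ_pow k (succ_pow l x) = x" if "x \<in> space M" "k + l = 0" for x k l
    using fun_cong[OF succ_pow_add[of k l], of x] that by (simp add: compose_def succ_pow_0)
  then have "bij_betw (succ_pow k) (space M) (space M)"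
    by (intro bij_betw_byWitness[where f' = "succ_pow (- k)"]) (auto simp: succ_pow_closed)
  then show ?thesis by (simp add: Bij_def succ_pow_def)
qed

text \<open>
  The set where the power \<open>k\<close> acts as \<open>g\<close> is mapped by \<open>g\<close> onto the set where the power \<open>-k\<close>
  acts as \<open>g\<inverse>\<close>; both families partition \<open>Y\<close>.
\<close>

lemma measure_preserving_succ_pow: "measure_preserving_map M (succ_pow k)"
proof -
  have \<alpha>_mp: "measure_preserving_map M (\<alpha> g)" if "g \<in> carrier G" for g
    using mp_action that by (simp add: mp_action_def)
  \<comment> \<open>\<open>A B g\<close> is the part of the preimage of \<open>B\<close> in
    \<open>Y\<close> where the power acts as \<open>g\<close>; \<open>A' B g\<close> turns out to be
    its image under \<open>g\<close>.\<close>
  define A where "A B g = {x \<in> Y. index k x = g} \<inter> (\<alpha> g -` B \<inter> space M)" for B g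
  define A' where "A' B g = {x \<in> Y. index (- k) x = inv g} \<inter> B" for B g
  have A_sets: "A B g \<in> sets M" if "g \<in> carrier G" "B \<in> sets M" for B g
    using \<alpha>_mp[OF that(1)] that unfolding A_def
    by (intro sets.Int sets_index measurable_sets[of _ M M]) (auto simp: measure_preserving_map_def)
  have A'_sets: "A' B g \<in> sets M" if "g \<in> carrier G" "B \<in> sets M" for B g
    using that by (simp add: A'_def sets_index sets.Int)
  have vimage: "succ_pow k -` B \<inter> space M = (\<Union>g\<in>carrier G. A B g) \<union> (B - Y)"
    if "B \<in> sets M" for B
    using sets.sets_into_space[OF that] Y_space
    by (auto simp: A_def succ_pow_def split: if_splits)
  \<comment> \<open>By \<open>index_uminus\<close>, a point \<open>x\<close> of \<open>Y\<close> has
    index \<open>g\<close> at \<open>k\<close> exactly when \<open>\<alpha> g x\<close> has index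
    \<open>inv g\<close> at \<open>- k\<close>.\<close>
  have vimage_A: "\<alpha> (inv g) -` A B g \<inter> space M = A' B g"
    if g: "g \<in> carrier G" and B: "B \<in> sets M" for B g
  proof (rule subset_antisym; rule subsetI)
    fix y assume y: "y \<in> \<alpha> (inv g) -` A B g \<inter> space M"
    define x where "x = \<alpha> (inv g) y"
    have x: "x \<in> Y" "index k x = g" "\<alpha> g x \<in> B" using y by (auto simp: A_def x_def)
    have "\<alpha> g x = y" using y g by (simp add: x_def composition_rule[symmetric])
    then show "y \<in> A' B g"
      using x index_uminus[OF x(1), of k] Y_invariant[OF g x(1)] by (simp add: A'_def)
  next
    fix y assume "y \<in> A' B g"
    then have y: "y \<in> Y" "index (- k) y = inv g" "y \<in> B" by (auto simp: A'_def)
    have "index k (\<alpha> (inv g) y) = g" using index_uminus[OF y(1), of "- k"] y(2) g by simp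
    moreover have "\<alpha> g (\<alpha> (inv g) y) = y"
      using y g Y_space by (simp add: composition_rule[symmetric])
    ultimately show "y \<in> \<alpha> (inv g) -` A B g \<inter> space M"
      using y g Y_space Y_invariant by (auto simp: A_def)
  qed
  have meas: "succ_pow k \<in> M \<rightarrow>\<^sub>M M"
  proof (rule measurableI)
    fix B assume "B \<in> sets M"
    then show "succ_pow k -` B \<inter> space M \<in> sets M"
      using A_sets countable_carrier Y_sets by (auto simp: vimage intro!: sets.countable_UN')
  qed (rule succ_pow_closed)
  have "emeasure M (succ_pow k -` B \<inter> space M) = emeasure M B" if B: "B \<in> sets M" for B
  proof -
    have sets: "(\<Union>g\<in>carrier G. A B g) \<in> sets M" "(\<Union>g\<in>carrier G. A' B g) \<in> sets M"
      using A_sets A'_sets countable_carrier B by (auto intro!: sets.countable_UN')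
    have A'_UN: "(\<Union>g\<in>carrier G. A' B g) = B \<inter> Y"
    proof
      show "B \<inter> Y \<subseteq> (\<Union>g\<in>carrier G. A' B g)"
      proof
        fix x assume "x \<in> B \<inter> Y"
        then show "x \<in> (\<Union>g\<in>carrier G. A' B g)"
          by (intro UN_I[of "inv (index (- k) x)"]) (auto simp: A'_def)
      qed
    qed (auto simp: A'_def)
    have "emeasure M (\<Union>g\<in>carrier G. A B g) = (\<integral>\<^sup>+g. emeasure M (A B g) \<partial>count_space (carrier G))"
      using A_sets B countable_carrier
      by (intro emeasure_UN_countable) (auto simp: disjoint_family_on_def A_def)
    also have "\<dots> = (\<integral>\<^sup>+g. emeasure M (A' B g) \<partial>count_space (carrier G))"
    proof (rule nn_integral_cong)
      fix g assume "g \<in> space (count_space (carrier G))"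
      then have "g \<in> carrier G" by simp
      \<comment> \<open>\<open>A' B g\<close> is the preimage of \<open>A B g\<close> under the
        measure-preserving map \<open>\<alpha> (inv g)\<close>.\<close>
      then show "emeasure M (A B g) = emeasure M (A' B g)"
        using measure_preserving_emeasure_vimage[OF \<alpha>_mp A_sets[OF _ B], of "inv g" g] B
        by (simp add: vimage_A)
    qed
    also have "\<dots> = emeasure M (\<Union>g\<in>carrier G. A' B g)"
      using A'_sets B countable_carrier
      by (intro emeasure_UN_countable[symmetric])
        (auto simp: disjoint_family_on_def A'_def dest: inv_inj[THEN inj_onD, rotated])
    finally have eq: "emeasure M (\<Union>g\<in>carrier G. A B g) = emeasure M (B \<inter> Y)"
      by (simp add: A'_UN)
    \<comment> \<open>Off \<open>Y\<close> the map is the identity and contributes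
      \<open>B - Y\<close> to the preimage.\<close>
    have "emeasure M (succ_pow k -` B \<inter> space M) =
        emeasure M (\<Union>g\<in>carrier G. A B g) + emeasure M (B - Y)"
      unfolding vimage[OF B] using sets B Y_sets
      by (intro plus_emeasure[symmetric]) (auto simp: A_def)
    also have "\<dots> = emeasure M (B \<inter> Y \<union> (B - Y))"
      unfolding eq using B Y_sets by (intro plus_emeasure) auto
    finally show ?thesis by (simp add: Int_Diff_Un)
  qed
  then have "distr M M (succ_pow k) = M"
    using meas by (intro measure_eqI) (simp_all add: emeasure_distr)
  with meas show ?thesis by (simp add: measure_preserving_map_def)
qed

lemma int_action_succ_pow: "int_action (space M) (succ_pow 1) = succ_pow"
  by (rule int_action_eqI) (rule succ_pow_Bij succ_pow_add)+

lemma mp_action_succ_pow: "mp_action integer_group M (int_action (space M) (succ_pow 1))"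
  unfolding mp_action_def
  by (auto simp: group_action_int_action succ_pow_Bij)
    (simp add: int_action_succ_pow measure_preserving_succ_pow)

section \<open>Orbits and almost everywhere versions of the powers\<close>

lemma orbit_eq:
  assumes "x \<in> Y"
  shows "orbit G \<alpha> x = range (\<lambda>k. \<alpha> (index k x) x)"
  unfolding orbit_def by (subst index_surj[OF assms]) auto

text \<open>\<open>T\<close> agrees with \<open>succ_pow 1\<close> only almost everywhere, but its
  powers preserve the measure, so almost every point has its whole \<open>T\<close>-orbit in the set
  of agreement. Induction in both directions then identifies all powers.\<close>

lemma AE_int_action_version:
  assumes Y: "AE x in M. x \<in> Y" and T: "invertible_version M (succ_map G \<alpha> \<psi>) T"
  shows "AE x in M. x \<in> Y \<and> (\<forall>k. int_action (space M) T k x = \<alpha> (index k x) x)"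
proof -
  let ?T = "int_action (space M) T"
  have Bij: "T \<in> Bij (space M)" and T_mp: "\<And>k. measure_preserving_map M (?T k)"
    using T by (auto simp: invertible_version_def mp_action_def)
  have "AE x in M. T x = succ_map G \<alpha> \<psi> x" using T by (simp add: invertible_version_def)
  then have "AE x in M. T x = succ_pow 1 x"
    using Y by eventually_elim (simp add: succ_map_def succ_pow_Y index_def)
  then have "AE x in M. \<forall>k. T (?T k x) = succ_pow 1 (?T k x)"
    unfolding AE_all_countable
    by (intro allI measure_preserving_AE[OF T_mp, where P = "\<lambda>y. T y = succ_pow 1 y"])
  with Y show ?thesis
  proof eventually_elim
    case (elim x)
    then have x: "x \<in> space M" by (simp add: Y_space)
    have T_add1: "?T (i + 1) x = T (?T i x)" for i
      using int_action_add[OF Bij x, of 1 i] by (simp add: int_action_1[OF Bij] add.commute)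
    have P_add1: "succ_pow (i + 1) x = succ_pow 1 (succ_pow i x)" for i
      using succ_pow_add[of 1 i] x by (simp add: compose_def add.commute)
    have "?T k x = succ_pow k x" for k
    proof (induction k rule: int_induct[where k = 0])
      case base
      show ?case by (simp add: x int_action_0 succ_pow_0)
    next
      case (step1 i)
      then show ?case using elim(2) T_add1 P_add1 by metis
    next
      case (step2 i)
      \<comment> \<open>Going down, injectivity of \<open>succ_pow 1\<close> cancels the last
        step.\<close>
      have "succ_pow 1 (?T (i - 1) x) = succ_pow 1 (succ_pow (i - 1) x)"
        using step2 elim T_add1[of "i - 1"] P_add1[of "i - 1"] by simp
      moreover have "?T (i - 1) x \<in> space M"
        using T_mp[of "i - 1"] x by (auto simp: measure_preserving_map_def dest: measurable_space)
      ultimately show ?case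
        using succ_pow_Bij[of 1] succ_pow_closed[OF x]
        by (auto simp: Bij_def bij_betw_def dest: inj_onD)
    qed
    then show ?case using elim by (simp add: succ_pow_Y)
  qed
qed

end

section \<open>Factor maps onto multiorders\<close>

text \<open>The field is tautological, so equivariance is immediate and no null set is
  discarded.\<close>

lemma order_field_multiorder:
  assumes "group G" "countable (carrier G)" "multiorder G \<nu>"
  shows "order_field G \<nu> (order_act G) (Z_orders G) (\<lambda>r. r)"
proof -
  interpret group G by fact
  have sets: "sets \<nu> = sets (Z_orders_space G)" using assms(3) by (simp add: multiorder_def)
  then have space: "space \<nu> = Z_orders G" by (simp add: sets_eq_imp_space_eq)
  have meas: "order_act G g \<in> \<nu> \<rightarrow>\<^sub>M \<nu>" if "g \<in> carrier G" for g
    using measurable_order_act[OF that] by (simp cong: measurable_cong_sets add: sets)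
  show ?thesis
  proof
    show "mp_action G \<nu> (order_act G)"
      using assms(3) meas group_action_order_act
      by (simp add: mp_action_def measure_preserving_map_def multiorder_def space)
    show "Z_orders G \<in> sets \<nu>" using space by (metis sets.top)
    have "restrict_space \<nu> (Z_orders G) = restrict_space \<nu> (space \<nu>)" by (simp add: space)
    then show "(\<lambda>r. r) \<in> restrict_space \<nu> (Z_orders G) \<rightarrow>\<^sub>M Z_orders_space G"
      using sets by (simp add: measurable_restrict_space1 measurable_ident_sets)
  qed (simp_all add: assms order_act_closed)
qed

text \<open>Equivariance may fail on a null set for each group element. Countability allows removing
  all of them at once, and keeping the points whose whole orbit avoids the bad set yields an
  invariant conull domain.\<close>

lemma order_field_factor_map:
  assumes "group G" "countable (carrier G)" "mp_action G M \<alpha>" "multiorder G \<nu>"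
    and \<phi>: "factor_map G M \<alpha> \<nu> (order_act G) D \<phi>"
  obtains Y where "order_field G M \<alpha> Y \<phi>" "AE x in M. x \<in> Y"
proof -
  interpret group G by fact
  interpret group_action G "space M" \<alpha> using assms(3) by (simp add: mp_action_def)
  have \<alpha>_mp: "measure_preserving_map M (\<alpha> g)" if "g \<in> carrier G" for g
    using assms(3) that by (simp add: mp_action_def)
  have "\<exists>N\<in>null_sets M. {x \<in> space M. \<phi> (\<alpha> g x) \<noteq> order_act G g (\<phi> x)} \<subseteq> N"
    if "g \<in> carrier G" for g
    using \<phi> that by (auto simp: factor_map_def eventually_ae_filter)
  then obtain N where N: "\<And>g. g \<in> carrier G \<Longrightarrow> N g \<in> null_sets M"
    and equiv: "\<And>g x. g \<in> carrier G \<Longrightarrow> x \<in> space M \<Longrightarrow> x \<notin> N g \<Longrightarrow>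
      \<phi> (\<alpha> g x) = order_act G g (\<phi> x)"
    by (auto simp: subset_iff) metis
  define E where "E = D - (\<Union>g\<in>carrier G. N g)"
  have UN_null: "(\<Union>g\<in>carrier G. N g) \<in> null_sets M"
    using N assms(2) by (intro null_sets_UN') auto
  have D: "D \<in> sets M" "AE x in M. x \<in> D" "\<phi> \<in> restrict_space M D \<rightarrow>\<^sub>M \<nu>"
    using \<phi> by (auto simp: factor_map_def)
  have E_sets: "E \<in> sets M" using D UN_null by (auto simp: E_def)
  have E_AE: "AE x in M. x \<in> E"
    using D(2) AE_not_in[OF UN_null] by eventually_elim (simp add: E_def)
  \<comment> \<open>This is the largest invariant subset of \<open>E\<close>.\<close>
  define Y where "Y = {x \<in> space M. \<forall>g\<in>carrier G. \<alpha> g x \<in> E}"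
  have Y_E: "x \<in> E" if "x \<in> Y" for x
  proof -
    have "\<alpha> \<one>\<^bsub>G\<^esub> x = x" using that id_eq_one by (metis (no_types, lifting) Y_def mem_Collect_eq restrict_apply')
    then show ?thesis using that by (force simp: Y_def)
  qed
  have "order_field G M \<alpha> Y \<phi>"
  proof
    have "{x \<in> space M. \<alpha> g x \<in> E} \<in> sets M" if "g \<in> carrier G" for g
      using \<alpha>_mp[OF that] measurable_sets[of "\<alpha> g" M M E] E_sets
      by (simp add: measure_preserving_map_def vimage_def Int_def conj_commute)
    then show Y_sets: "Y \<in> sets M"
      unfolding Y_def using assms(2) by (intro sets.sets_Collect_countable_All')
    show "\<alpha> g x \<in> Y" if "g \<in> carrier G" "x \<in> Y" for g x
      using that surj_prop[OF that(1)] by (auto simp: Y_def composition_rule[symmetric])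
    show "\<phi> (\<alpha> g x) = order_act G g (\<phi> x)" if "g \<in> carrier G" "x \<in> Y" for g x
      using that Y_E[OF that(2)] by (intro equiv) (auto simp: Y_def E_def)
    \<comment> \<open>Measurability of \<open>\<phi>\<close> is given on \<open>D\<close>, from
      which it restricts to \<open>Y\<close>.\<close>
    have "Y \<subseteq> D" using Y_E by (auto simp: E_def)
    then have "\<phi> \<in> restrict_space M Y \<rightarrow>\<^sub>M \<nu>"
      using measurable_restrict_space1[OF D(3), of Y] D(1) Y_sets
      by (simp add: restrict_restrict_space sets.Int_space_eq2 Int_absorb1)
    then show "\<phi> \<in> restrict_space M Y \<rightarrow>\<^sub>M Z_orders_space G"
      using assms(4) by (simp add: multiorder_def cong: measurable_cong_sets)
  qed (use assms in simp_all)
  moreover have "AE x in M. \<forall>g\<in>carrier G. \<alpha> g x \<in> E"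
    using assms(2) measure_preserving_AE[OF \<alpha>_mp E_AE] by (simp add: AE_ball_countable)
  then have "AE x in M. x \<in> Y"
    using AE_space by eventually_elim (simp add: Y_def)
  ultimately show thesis by (rule that)
qed

text \<open>Since the successor map is meaningful only almost everywhere, the claims are asserted
  for every invertible version of it, besides the existence of one.\<close>

theorem theorem3p5:
  fixes G :: "('g, 'm) monoid_scheme" (structure)
    and M :: "'x measure" and \<alpha> :: "'g \<Rightarrow> 'x \<Rightarrow> 'x"
    and \<nu> :: "'g rel measure"
    and D :: "'x set" and \<phi> :: "'x \<Rightarrow> 'g rel"
  assumes "group G" and "countable (carrier G)" and "infinite (carrier G)"
    and "prob_space M" and "mp_action G M \<alpha>"
    and "multiorder G \<nu>"
    and "factor_map G M \<alpha> \<nu> (order_act G) D \<phi>"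
  shows "(\<exists>T. invertible_version M (succ_map G \<alpha> \<phi>) T) \<and>
    (\<forall>T. invertible_version M (succ_map G \<alpha> \<phi>) T \<longrightarrow>
       orbit_equivalent_via_id M G \<alpha> integer_group (int_action (space M) T) \<and>
       (\<forall>k. AE x in M. int_action (space M) T k x = \<alpha> (order_index G (\<phi> x) k) x) \<and>
       factor_map integer_group M (int_action (space M) T)
         \<nu> (int_action (space \<nu>) (succ_order G)) D \<phi>) \<and>
    measure_preserving_map \<nu> (succ_order G) \<and>
    mp_action integer_group \<nu> (int_action (space \<nu>) (succ_order G))"
proof -
  obtain Y where "order_field G M \<alpha> Y \<phi>" and Y: "AE x in M. x \<in> Y"
    using order_field_factor_map assms by metis
  then interpret M: order_field G M \<alpha> Y \<phi> by simp
  interpret N: order_field G \<nu> "order_act G" "Z_orders G" "\<lambda>r. r"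
    using assms by (intro order_field_multiorder)
  have space: "space \<nu> = Z_orders G"
    using assms(6) by (auto simp: multiorder_def dest: sets_eq_imp_space_eq)
  \<comment> \<open>For the multiorder the invariant set is the whole space, so this equality holds
    everywhere and not just almost everywhere.\<close>
  have succ_order: "succ_order G = N.succ_pow 1"
    by (auto simp: succ_order_def N.succ_pow_def N.index_def space fun_eq_iff)
  have "AE x in M. M.succ_pow 1 x = succ_map G \<alpha> \<phi> x"
    using Y by eventually_elim (simp add: succ_map_def M.succ_pow_Y M.index_def)
  then have "invertible_version M (succ_map G \<alpha> \<phi>) (M.succ_pow 1)"
    by (simp add: invertible_version_def M.succ_pow_Bij M.mp_action_succ_pow)
  moreover have
    "orbit_equivalent_via_id M G \<alpha> integer_group (int_action (space M) T) \<and>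
     (\<forall>k. AE x in M. int_action (space M) T k x = \<alpha> (order_index G (\<phi> x) k) x) \<and>
     factor_map integer_group M (int_action (space M) T)
       \<nu> (int_action (space \<nu>) (succ_order G)) D \<phi>"
    if T: "invertible_version M (succ_map G \<alpha> \<phi>) T" for T
  proof (intro conjI)
    note powers = M.AE_int_action_version[OF Y T]
    have "AE x in M. orbit G \<alpha> x = orbit integer_group (int_action (space M) T) x"
      using powers by eventually_elim (simp add: M.orbit_eq, auto simp: orbit_def)
    then show "orbit_equivalent_via_id M G \<alpha> integer_group (int_action (space M) T)"
      using T assms(5) by (simp add: orbit_equivalent_via_id_def invertible_version_def)
    show "\<forall>k. AE x in M. int_action (space M) T k x = \<alpha> (order_index G (\<phi> x) k) x"
      using powers by (auto simp: M.index_def)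
    \<comment> \<open>Both sides are \<open>\<phi> x\<close> translated by its element of index
      \<open>k\<close>: the left by equivariance, the right by the powers of
      \<open>succ_order\<close>.\<close>
    have "AE x in M. \<phi> (int_action (space M) T k x) = int_action (space \<nu>) (succ_order G) k (\<phi> x)"
      for k
      using powers
      by eventually_elim
        (simp add: M.equivariant succ_order N.int_action_succ_pow N.succ_pow_Y M.\<psi>_Z_orders
          M.index_def N.index_def)
    \<comment> \<open>Domain, measurability and image measure are those of the given factor map;
      only equivariance depends on the acting group.\<close>
    then show "factor_map integer_group M (int_action (space M) T)
        \<nu> (int_action (space \<nu>) (succ_order G)) D \<phi>"
      using assms(7) by (simp add: factor_map_def)
  qed
  ultimately show ?thesis
    using N.measure_preserving_succ_pow N.mp_action_succ_pow by (auto simp: succ_order)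
qed

end
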